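(* Let $s,t\ge0$ and $r>1$. Then $$s\,t^{r-1}\Big[\log(e+t)+\frac{t}{r(e+t)}\Big]\le\frac{s^r}{r}\log(e+s)+t^r\Big[\frac{r-1}{r}\log(e+t)+\frac{t}{r(e+t)}\Big].$$
   Context: $e$ is Euler's number and $\log$ is the natural logarithm. *)

theory Defs
  imports Complex_Main
begin

end

theory Submission
  imports Defs "HOL-Analysis.Derivative"
begin

text \<open>
  The inequality says that the function \<open>\<phi>(x) = x\<^sup>r log(e + x) / r\<close> lies above its tangent line at \<open>t\<close>:
  the factor of \<open>s\<close> on the left is \<open>\<phi>'(t)\<close>, and the last summand on the right is
  \<open>t \<phi>'(t) - \<phi>(t)\<close>, so the claim reads \<open>\<phi>(t) + \<phi>'(t) (s - t) \<le> \<phi>(s)\<close>.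
  Now \<open>\<phi>'(x) = x\<^bsup>r-1\<^esup> (log(e + x) + x / (r (e + x)))\<close> is a product of nonnegative
  increasing functions, so \<open>\<phi>\<close> is convex on the positive half-line and the tangent inequality holds
  there. If \<open>s = 0\<close> or \<open>t = 0\<close>, the left side vanishes and the right side is nonnegative.
\<close>

definition power_log :: "real \<Rightarrow> real \<Rightarrow> real" where
  "power_log r x = x powr r / r * ln (exp 1 + x)"

definition power_log_deriv :: "real \<Rightarrow> real \<Rightarrow> real" where
  "power_log_deriv r x = x powr (r - 1) * (ln (exp 1 + x) + x / (r * (exp 1 + x)))"

lemma has_real_derivative_power_log:
  assumes "x > 0" "r > 0"
  shows "(power_log r has_real_derivative power_log_deriv r x) (at x)"
proof -
  have pos: "exp 1 + x > 0"
    using assms by (simp add: add_pos_pos)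
  have split: "x powr r = x * x powr (r - 1)"
    using assms by (simp add: powr_mult_base)
  have "((\<lambda>x. x powr r / r * ln (exp 1 + x)) has_real_derivative
      x powr (r - 1) * ln (exp 1 + x) + x powr r / r * (1 / (exp 1 + x))) (at x)"
    using assms pos by (auto intro!: derivative_eq_intros simp: add_divide_distrib mult.commute)
  moreover have "x powr (r - 1) * ln (exp 1 + x) + x powr r / r * (1 / (exp 1 + x))
      = power_log_deriv r x"
    unfolding power_log_deriv_def split by (simp add: algebra_simps)
  ultimately show ?thesis
    by (simp add: power_log_def [abs_def])
qed

lemma ln_exp_1_add_nonneg:
  assumes "x \<ge> 0"
  shows "ln (exp 1 + x) \<ge> (0 :: real)"
proof -
  have "(1 :: real) \<le> exp 1"
    by simp
  then show ?thesis
    using assms by (intro ln_ge_zero) linarith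
qed

lemma power_log_deriv_mono:
  assumes "0 < x" "x \<le> y" "r \<ge> 1"
  shows "power_log_deriv r x \<le> power_log_deriv r y"
proof -
  have pos: "exp 1 + x > 0" "exp 1 + y > 0"
    using assms by (simp_all add: add_pos_pos)
  have "x / (exp 1 + x) \<le> y / (exp 1 + y)"
    using assms pos by (simp add: divide_simps) (simp add: algebra_simps)
  then have "x / (exp 1 + x) / r \<le> y / (exp 1 + y) / r"
    using assms by (intro divide_right_mono) auto
  then have quotient: "x / (r * (exp 1 + x)) \<le> y / (r * (exp 1 + y))"
    by (simp add: mult.commute)
  have "ln (exp 1 + x) \<le> ln (exp 1 + y)"
    using assms pos by simp
  moreover have "x powr (r - 1) \<le> y powr (r - 1)"
    using assms by (intro powr_mono2) auto
  ultimately show ?thesis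
    unfolding power_log_deriv_def
    using quotient assms pos ln_exp_1_add_nonneg[of x]
    by (intro mult_mono add_mono add_nonneg_nonneg) auto
qed

lemma convex_on_power_log:
  assumes "r \<ge> 1"
  shows "convex_on {0<..} (power_log r)"
  using assms
  by (intro convex_on_realI[where f' = "power_log_deriv r"])
     (auto intro!: has_real_derivative_power_log power_log_deriv_mono)

theorem lemma4p3:
  fixes s t r :: real
  assumes "s \<ge> 0" and "t \<ge> 0" and "r > 1"
  shows "s * t powr (r - 1) * (ln (exp 1 + t) + t / (r * (exp 1 + t)))
    \<le> s powr r / r * ln (exp 1 + s)
      + t powr r * ((r - 1) / r * ln (exp 1 + t) + t / (r * (exp 1 + t)))"
proof (cases "s = 0 \<or> t = 0")
  case True
  have "0 \<le> s powr r / r * ln (exp 1 + s)"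
    using assms ln_exp_1_add_nonneg[of s] by simp
  moreover have "0 \<le> t powr r * ((r - 1) / r * ln (exp 1 + t) + t / (r * (exp 1 + t)))"
    using assms ln_exp_1_add_nonneg[of t] by (simp add: add_nonneg_nonneg)
  ultimately show ?thesis
    using True by auto
next
  case False
  then have st: "s > 0" "t > 0"
    using assms by auto
  have "power_log r s - power_log r t \<ge> power_log_deriv r t * (s - t)"
  proof (rule convex_on_imp_above_tangent)
    show "convex_on {0<..} (power_log r)"
      using assms by (intro convex_on_power_log) simp
    show "(power_log r has_real_derivative power_log_deriv r t) (at t within {0<..})"
      using assms st by (intro DERIV_subset[OF has_real_derivative_power_log]) auto
  qed (use st in \<open>auto simp: interior_open\<close>)
  moreover have "t * power_log_deriv r t - power_log r t
      = t powr r * ((r - 1) / r * ln (exp 1 + t) + t / (r * (exp 1 + t)))"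
  proof -
    have split: "t powr r = t * t powr (r - 1)"
      using st by (simp add: powr_mult_base)
    have coeff: "(r - 1) / r = 1 - 1 / r"
      using assms by (simp add: field_simps)
    show ?thesis
      unfolding power_log_def power_log_deriv_def split coeff by (simp add: algebra_simps)
  qed
  moreover have "s * power_log_deriv r t
      = s * t powr (r - 1) * (ln (exp 1 + t) + t / (r * (exp 1 + t)))"
    by (simp add: power_log_deriv_def)
  ultimately show ?thesis
    by (simp add: power_log_def algebra_simps)
qed

end
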